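(* Let $\Xi_F=(S,\mathrm{wt})$ be a full passport with $|S|=N\ge 2$. Then the number of positive permutations of $\Xi_F$ is \[ |\mathbf{P}_+(\Xi_F)| = \sum_{\mathfrak{p}\in\mathfrak{P}(\Xi_F)} (-1)^{|\mathfrak{p}|-1} X(\mathfrak{p}). \]
   Context: A full passport $\Xi_F=(S,\mathrm{wt})$ consists of a finite set $S$ and a function $\mathrm{wt}:S\to\mathbb{R}\setminus\{0\}$ with $\sum_{s\in S}\mathrm{wt}(s)=0$; write $|\Xi_F|=|S|$. For a nonempty $S'\subseteq S$ with $\sum_{s\in S'}\mathrm{wt}(s)=0$, the subpassport $\Xi(S')$ is the full passport $(S',\mathrm{wt}|_{S'})$. A partition of $\Xi_F$ is a set $\mathfrak{p}=\{\Xi(S_1),\dots,\Xi(S_n)\}$ of subpassports such that $S=\bigsqcup_{i} S_i$ with each $S_i$ nonempty and of zero weight sum; its length is $|\mathfrak{p}|=n$, and $X(\mathfrak{p})=\prod_{i=1}^n(|S_i|-1)!$. $\mathfrak{P}(\Xi_F)$ is the set of all partitions of $\Xi_F$. A permutation of $\Xi_F$ is a sequence $(s_1,\dots,s_N)$ listing every element of $S$ exactly once; its cumulative sums are $H_0=0$ and $H_i=\sum_{j=1}^i\mathrm{wt}(s_j)$. The permutation is positive if $H_i>0$ for all $1\le i\le N-1$; $\mathbf{P}_+(\Xi_F)$ denotes the set of positive permutations. *)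

theory Defs
  imports Complex_Main "HOL-Library.Disjoint_Sets" "HOL-Combinatorics.Multiset_Permutations"
begin

definition full_passport :: "'a set \<Rightarrow> ('a \<Rightarrow> real) \<Rightarrow> bool" where
  "full_passport S wt \<longleftrightarrow> finite S \<and> (\<forall>s\<in>S. wt s \<noteq> 0) \<and> (\<Sum>s\<in>S. wt s) = 0"

(* The subpassport on S' is (S', wt restricted to S'), so for a fixed wt it is determined
   by S'; a partition of the passport is therefore represented by its set of underlying
   blocks. Nonemptiness of the blocks is part of partition_on. *)
definition passport_partitions :: "'a set \<Rightarrow> ('a \<Rightarrow> real) \<Rightarrow> 'a set set set" where
  "passport_partitions S wt =
     {p. partition_on S p \<and> (\<forall>B\<in>p. full_passport B wt)}"

definition X :: "'a set set \<Rightarrow> nat" where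
  "X p = (\<Prod>B\<in>p. fact (card B - 1))"

(* Lists are indexed from 0, so the first i terms s_1, ..., s_i are xs ! 0, ..., xs ! (i - 1). *)
definition cumulative_sum :: "('a \<Rightarrow> real) \<Rightarrow> 'a list \<Rightarrow> nat \<Rightarrow> real" where
  "cumulative_sum wt xs i = (\<Sum>j<i. wt (xs ! j))"

definition positive_permutations :: "'a set \<Rightarrow> ('a \<Rightarrow> real) \<Rightarrow> 'a list set" where
  "positive_permutations S wt =
     {xs \<in> permutations_of_set S. \<forall>i\<in>{1..<card S}. cumulative_sum wt xs i > 0}"

end

theory Submission
  imports Defs
begin

text \<open>
  Let \<open>P(S)\<close> be the number of positive permutations and \<open>C(S) = (|S| - 1)!\<close> the number of cyclic
  orders, represented as the linear orders starting with a fixed \<open>a \<in> S\<close>. Cutting a cyclic order of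
  a zero-sum set wherever its cumulative sum is minimal gives a cycle of positive blocks. If there
  is one block, it is a positive permutation of \<open>S\<close>; otherwise the block following the one that
  contains \<open>a\<close> can be removed, and it can be put back at the first minimum after \<open>a\<close>. Hence
  \<open>C(S) = P(S) + \<Sum> C(B) P(S - B)\<close>, the sum being over the zero-sum proper subsets \<open>B\<close> containing
  \<open>a\<close>. Splitting off the block of \<open>a\<close> gives the same recurrence for the alternating sum over
  partitions.
\<close>

section \<open>First minima of cumulative sums\<close>

definition weight :: "('a \<Rightarrow> real) \<Rightarrow> 'a list \<Rightarrow> real" where
  "weight wt xs = sum_list (map wt xs)"

lemma weight_simps [simp]:
  "weight wt [] = 0"
  "weight wt (x # xs) = wt x + weight wt xs"
  "weight wt (xs @ ys) = weight wt xs + weight wt ys"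
  by (simp_all add: weight_def)

lemma weight_eq_sum: "distinct xs \<Longrightarrow> weight wt xs = sum wt (set xs)"
  by (simp add: weight_def sum_list_distinct_conv_sum_set)

text \<open>Splittings \<open>zs = x @ y\<close> replace indices, so that positivity combines
  directly with decompositions of lists. The empty list qualifies, hence the separate conditions
  \<open>v \<noteq> []\<close> below.\<close>

definition positive_list :: "('a \<Rightarrow> real) \<Rightarrow> 'a list \<Rightarrow> bool" where
  "positive_list wt zs \<longleftrightarrow> weight wt zs = 0 \<and>
     (\<forall>x y. zs = x @ y \<longrightarrow> x \<noteq> [] \<longrightarrow> y \<noteq> [] \<longrightarrow> weight wt x > 0)"

text \<open>The cumulative sums of \<open>u @ w\<close>, the empty one excluded, attain their minimum for the first
  time after \<open>u\<close>.\<close>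

definition first_min :: "('a \<Rightarrow> real) \<Rightarrow> 'a list \<Rightarrow> 'a list \<Rightarrow> bool" where
  "first_min wt u w \<longleftrightarrow> u \<noteq> [] \<and>
     (\<forall>x y. u = x @ y \<longrightarrow> x \<noteq> [] \<longrightarrow> y \<noteq> [] \<longrightarrow> weight wt y < 0) \<and>
     (\<forall>x y. w = x @ y \<longrightarrow> weight wt x \<ge> 0)"

lemma first_minD:
  assumes "first_min wt u w"
  shows "u \<noteq> []"
    and "u = x @ y \<Longrightarrow> x \<noteq> [] \<Longrightarrow> y \<noteq> [] \<Longrightarrow> weight wt y < 0"
    and "w = x @ y \<Longrightarrow> weight wt x \<ge> 0"
  using assms unfolding first_min_def by blast+

lemma positive_listD:
  assumes "positive_list wt zs"
  shows "weight wt zs = 0"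
    and "zs = x @ y \<Longrightarrow> x \<noteq> [] \<Longrightarrow> y \<noteq> [] \<Longrightarrow> weight wt x > 0"
  using assms unfolding positive_list_def by blast+

text \<open>If one candidate is longer by \<open>t\<close>, minimality at the shorter one makes the
  weight of \<open>t\<close> nonnegative, while strictness at the longer one makes it negative
  unless \<open>t = []\<close>.\<close>

lemma first_min_unique:
  assumes "first_min wt u w" "first_min wt u' w'" "u @ w = u' @ w'"
  shows "u = u' \<and> w = w'"
proof -
  have *: "t = []" if "first_min wt u (t @ w)" "first_min wt (u @ t) w" for u w t
    using first_minD(1,3)[OF that(1)] first_minD(2)[OF that(2)] by fastforce
  from assms(3) obtain t where "u = u' @ t \<and> t @ w = w' \<or> u @ t = u' \<and> w = t @ w'"
    by (auto simp: append_eq_append_conv2)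
  with * assms(1,2) show ?thesis by auto
qed

text \<open>Prepending \<open>a\<close> shifts all old cumulative sums equally, so the first minimum
  stays in place unless the new prefix \<open>[a]\<close> is at least as low. The sign of
  \<open>weight wt u\<close> decides this.\<close>

lemma ex_first_min:
  assumes "xs \<noteq> []"
  shows "\<exists>u w. xs = u @ w \<and> first_min wt u w"
  using assms
proof (induction xs)
  case (Cons a xs)
  show ?case
  proof (cases "xs = []")
    case True
    then have "a # xs = [a] @ [] \<and> first_min wt [a] []"
      by (auto simp: first_min_def Cons_eq_append_conv)
    then show ?thesis by blast
  next
    case False
    with Cons obtain u w where uw: "xs = u @ w" "first_min wt u w" by auto
    show ?thesis
    proof (cases "weight wt u < 0")
      case True
      have "first_min wt (a # u) w"
        unfolding first_min_def
      proof (intro conjI allI impI)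
        fix x y assume "a # u = x @ y" "x \<noteq> []" "y \<noteq> []"
        then obtain x' where "u = x' @ y" by (auto simp: Cons_eq_append_conv)
        \<comment> \<open>The only splitting not inherited from \<open>u\<close> is
          \<open>x = [a]\<close>, \<open>y = u\<close>; it is covered by the case
          assumption.\<close>
        with True first_minD(2)[OF uw(2) this] \<open>y \<noteq> []\<close> show "weight wt y < 0"
          by (cases "x' = []") auto
      qed (use first_minD(3)[OF uw(2)] in auto)
      with uw(1) show ?thesis by (metis append_Cons)
    next
      case False
      have "first_min wt [a] (u @ w)"
        unfolding first_min_def
      proof (intro conjI allI impI)
        fix x y assume "u @ w = x @ y"
        then consider t where "u = x @ t" "y = t @ w" | t where "x = u @ t" "w = t @ y"
          by (auto simp: append_eq_append_conv2)
        then show "weight wt x \<ge> 0"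
        proof cases
          case 1
          then show ?thesis
            using first_minD(2)[OF uw(2) 1(1)] False by (cases "x = []"; cases "t = []") auto
        next
          case 2
          then show ?thesis using first_minD(3)[OF uw(2) 2(2)] False by auto
        qed
      qed (auto simp: Cons_eq_append_conv)
      with uw(1) show ?thesis by (metis append_Cons append_Nil)
    qed
  qed
qed simp

text \<open>Were one list a proper prefix of the other, its weight would be positive by positivity
  of the longer and zero by its own.\<close>

lemma positive_prefix_unique:
  assumes "positive_list wt v" "positive_list wt v'" "v \<noteq> []" "v' \<noteq> []" "v @ w = v' @ w'"
  shows "v = v' \<and> w = w'"
proof -
  have *: "t = []" if "positive_list wt (v @ t)" "positive_list wt v" "v \<noteq> []" for v t
    using positive_listD(1)[OF that(2)] positive_listD(2)[OF that(1) refl that(3)] by fastforce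
  from assms(5) obtain t where "v = v' @ t \<and> t @ w = w' \<or> v @ t = v' \<and> w = t @ w'"
    by (auto simp: append_eq_append_conv2)
  with * assms show ?thesis by auto
qed

text \<open>The shortest nonempty prefix of weight at most zero works: \<open>nonneg\<close> makes
  its weight zero, and minimality makes its proper nonempty prefixes positive.\<close>

lemma ex_positive_prefix:
  assumes nonneg: "\<And>x y. w = x @ y \<Longrightarrow> weight wt x \<ge> 0"
    and ex: "\<exists>x y. w = x @ y \<and> x \<noteq> [] \<and> weight wt x \<le> 0"
  shows "\<exists>v w'. w = v @ w' \<and> v \<noteq> [] \<and> positive_list wt v"
proof -
  let ?Q = "\<lambda>v. (\<exists>y. w = v @ y) \<and> v \<noteq> [] \<and> weight wt v \<le> 0"
  obtain v where v: "?Q v" and min: "\<And>v'. ?Q v' \<Longrightarrow> length v \<le> length v'"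
    using ex ex_has_least_nat[of ?Q _ length] by blast
  from v obtain w' where w': "w = v @ w'" by blast
  have "positive_list wt v"
    unfolding positive_list_def
  proof (intro conjI allI impI)
    show "weight wt v = 0" using v nonneg[OF w'] by auto
    fix x y assume "v = x @ y" "x \<noteq> []" "y \<noteq> []"
    then show "weight wt x > 0" using min[of x] w' by force
  qed
  with v w' show ?thesis by blast
qed

text \<open>Sums inside \<open>v\<close> stay at or above the level reached after \<open>u\<close>,
  and sums beyond \<open>v\<close> are unchanged. So a positive block can be inserted or deleted
  there without moving the first minimum.\<close>

lemma first_min_insert_iff:
  assumes "positive_list wt v"
  shows "first_min wt u (v @ w) \<longleftrightarrow> first_min wt u w"
proof -
  have v0: "weight wt v = 0" by (rule positive_listD(1)[OF assms])
  have "(\<forall>x y. v @ w = x @ y \<longrightarrow> weight wt x \<ge> 0) \<longleftrightarrow> (\<forall>x y. w = x @ y \<longrightarrow> weight wt x \<ge> 0)"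
  proof (intro iffI allI impI)
    fix x y assume "\<forall>x y. v @ w = x @ y \<longrightarrow> weight wt x \<ge> 0" "w = x @ y"
    then have "weight wt (v @ x) \<ge> 0" by (metis append_assoc)
    with v0 show "weight wt x \<ge> 0" by simp
  next
    fix x y assume *: "\<forall>x y. w = x @ y \<longrightarrow> weight wt x \<ge> 0" and "v @ w = x @ y"
    then consider t where "v = x @ t" | t where "x = v @ t" "w = t @ y"
      by (auto simp: append_eq_append_conv2)
    then show "weight wt x \<ge> 0"
    proof cases
      case 1
      then show ?thesis
        using positive_listD(2)[OF assms 1] v0 by (cases "x = []"; cases "t = []") auto
    next
      case 2
      with * v0 show ?thesis by auto
    qed
  qed
  then show ?thesis unfolding first_min_def by blast
qed

text \<open>As the total is zero, a prefix \<open>w @ x\<close> of the rotation weighs minus the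
  rest of \<open>u\<close>. The right-hand side says that the minimum after \<open>u\<close> is
  attained only once.\<close>

lemma positive_rotate_iff:
  assumes "u \<noteq> []" "weight wt (u @ w) = 0"
  shows "positive_list wt (w @ u) \<longleftrightarrow>
    first_min wt u w \<and> (\<forall>x y. w = x @ y \<longrightarrow> x \<noteq> [] \<longrightarrow> weight wt x > 0)"
    (is "?L \<longleftrightarrow> ?R")
proof
  assume L: ?L
  have pos: "weight wt x > 0" if "w = x @ y" "x \<noteq> []" for x y
    using positive_listD(2)[OF L, of x "y @ u"] that assms(1) by simp
  have "weight wt y < 0" if "u = x @ y" "x \<noteq> []" "y \<noteq> []" for x y
    using positive_listD(2)[OF L, of "w @ x" y] that assms by simp
  moreover have "weight wt x \<ge> 0" if "w = x @ y" for x y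
    using pos[OF that] by (cases "x = []") auto
  ultimately show ?R using pos assms(1) unfolding first_min_def by blast
next
  assume R: ?R
  show ?L unfolding positive_list_def
  proof (intro conjI allI impI)
    show "weight wt (w @ u) = 0" using assms(2) by simp
    fix x y assume xy: "w @ u = x @ y" "x \<noteq> []" "y \<noteq> []"
    then obtain t where "w = x @ t \<or> x = w @ t \<and> u = t @ y"
      by (auto simp: append_eq_append_conv2)
    \<comment> \<open>For \<open>t = []\<close> the second alternative gives \<open>x = w\<close>
      and falls under the first, so \<open>t\<close> may be taken nonempty.\<close>
    then consider "w = x @ t" | "x = w @ t" "u = t @ y" "t \<noteq> []"
      by (cases "t = []") auto
    then show "weight wt x > 0"
    proof cases
      case 1
      with R xy show ?thesis by blast
    next
      case 2
      then have "weight wt y < 0" using first_minD(2)[of wt u w t y] R xy by blast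
      then show ?thesis using 2 assms(2) by simp
    qed
  qed
qed

section \<open>The recurrence for positive permutations\<close>

text \<open>The cumulative sum at \<open>i\<close> is the weight of \<open>take i xs\<close>, and
  the indices from 1 to \<open>card S - 1\<close> are exactly the cuts into two nonempty
  lists.\<close>

lemma positive_permutations_eq:
  assumes "sum wt S = 0"
  shows "positive_permutations S wt = {xs. distinct xs \<and> set xs = S \<and> positive_list wt xs}"
proof -
  have "(\<forall>i\<in>{1..<card S}. cumulative_sum wt xs i > 0) \<longleftrightarrow> positive_list wt xs"
    if xs: "distinct xs" "set xs = S" for xs
  proof -
    have cum: "cumulative_sum wt (x @ y) (length x) = weight wt x" for x y :: "'a list"
      by (simp add: cumulative_sum_def weight_def sum_list_sum_nth nth_append atLeast0LessThan)
    have N: "card S = length xs" using xs distinct_card by force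
    have w0: "weight wt xs = 0" using xs assms by (simp add: weight_eq_sum)
    show ?thesis
    proof
      assume A: "\<forall>i\<in>{1..<card S}. cumulative_sum wt xs i > 0"
      show "positive_list wt xs" unfolding positive_list_def
      proof (intro conjI allI impI w0)
        fix x y assume "xs = x @ y" "x \<noteq> []" "y \<noteq> []"
        then show "weight wt x > 0" using A[rule_format, of "length x"] cum[of x y] N
          by (simp add: Suc_le_eq)
      qed
    next
      assume A: "positive_list wt xs"
      show "\<forall>i\<in>{1..<card S}. cumulative_sum wt xs i > 0"
      proof
        fix i assume i: "i \<in> {1..<card S}"
        then have "take i xs \<noteq> []" "drop i xs \<noteq> []" using N by auto
        then have "weight wt (take i xs) > 0"
          using positive_listD(2)[OF A, of "take i xs" "drop i xs"] by simp
        then show "cumulative_sum wt xs i > 0"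
          using cum[of "take i xs" "drop i xs"] i N by simp
      qed
    qed
  qed
  then show ?thesis
    unfolding positive_permutations_def permutations_of_set_def by blast
qed

section \<open>Cyclic orders and their cuts at the first minimum\<close>

definition rooted_lists :: "'a \<Rightarrow> 'a set \<Rightarrow> 'a list set" where
  "rooted_lists a S = {xs. distinct xs \<and> set xs = S \<and> hd xs = a}"

lemma card_rooted_lists:
  assumes "finite S" "a \<in> S"
  shows "card (rooted_lists a S) = fact (card S - 1)"
proof -
  have "rooted_lists a S = (#) a ` permutations_of_set (S - {a})"
  proof (intro set_eqI iffI)
    fix xs assume "xs \<in> rooted_lists a S"
    with assms(2) show "xs \<in> (#) a ` permutations_of_set (S - {a})"
      by (cases xs) (auto simp: rooted_lists_def permutations_of_set_def)
  next
    fix xs assume "xs \<in> (#) a ` permutations_of_set (S - {a})"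
    then obtain ys where "xs = a # ys" "set ys = S - {a}" "distinct ys"
      by (blast dest: permutations_of_setD)
    with assms(2) show "xs \<in> rooted_lists a S" by (simp add: rooted_lists_def insert_absorb)
  qed
  then show ?thesis using assms by (simp add: card_image)
qed

lemma finite_rooted_lists: "finite S \<Longrightarrow> finite (rooted_lists a S)"
  by (rule finite_subset[OF _ finite_permutations_of_set[of S]])
     (simp add: rooted_lists_def permutations_of_set_def Collect_mono)

text \<open>The two kinds of cyclic orders rooted at \<open>a\<close>: \<open>u @ w\<close> consists of the single positive block
  \<open>w @ u\<close>, and in \<open>u @ v @ w\<close> the positive block \<open>v\<close> follows the one that contains \<open>a\<close>.\<close>

definition single_splits :: "('a \<Rightarrow> real) \<Rightarrow> 'a \<Rightarrow> 'a set \<Rightarrow> ('a list \<times> 'a list) set" where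
  "single_splits wt a S = {(u, w). u @ w \<in> rooted_lists a S \<and> u \<noteq> [] \<and> positive_list wt (w @ u)}"

definition block_splits ::
    "('a \<Rightarrow> real) \<Rightarrow> 'a \<Rightarrow> 'a set \<Rightarrow> ('a list \<times> 'a list \<times> 'a list) set" where
  "block_splits wt a S = {(u, v, w). u @ v @ w \<in> rooted_lists a S \<and> first_min wt u w \<and>
     v \<noteq> [] \<and> positive_list wt v}"

lemma rooted_lists_weight:
  assumes "xs \<in> rooted_lists a S" "sum wt S = 0"
  shows "weight wt xs = 0"
  using assms by (auto simp: rooted_lists_def weight_eq_sum)

lemma single_splits_first_min:
  assumes "(u, w) \<in> single_splits wt a S" "sum wt S = 0"
  shows "first_min wt u w" "\<And>x y. w = x @ y \<Longrightarrow> x \<noteq> [] \<Longrightarrow> weight wt x > 0"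
  using assms positive_rotate_iff[of u wt w] rooted_lists_weight[of "u @ w" a S wt]
  by (auto simp: single_splits_def)

text \<open>Both forms are needed: the one with \<open>v\<close> recovers \<open>u\<close> from
  \<open>u @ v @ w\<close>, the one without \<open>v\<close> recovers it from
  \<open>u @ w\<close>.\<close>

lemma block_splits_first_min:
  assumes "(u, v, w) \<in> block_splits wt a S"
  shows "first_min wt u (v @ w)" "first_min wt u w" "v \<noteq> []" "positive_list wt v"
  using assms first_min_insert_iff[of wt v u w] by (auto simp: block_splits_def)

text \<open>The inverse cuts a positive permutation just before \<open>a\<close>, since
  \<open>u\<close> begins with the only occurrence of \<open>a\<close>.\<close>

lemma bij_single_splits:
  assumes "a \<in> S" "sum wt S = 0"
  shows "bij_betw (\<lambda>(u, w). w @ u) (single_splits wt a S) (positive_permutations S wt)"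
  unfolding bij_betw_def
proof
  show "inj_on (\<lambda>(u, w). w @ u) (single_splits wt a S)"
  proof (intro inj_onI, clarify)
    fix u w u' w'
    assume A: "(u, w) \<in> single_splits wt a S" "(u', w') \<in> single_splits wt a S"
      and eq: "w @ u = w' @ u'"
    have *: "\<exists>r. u = a # r \<and> a \<notin> set r \<and> a \<notin> set w"
      if "(u, w) \<in> single_splits wt a S" for u w
      using that by (cases u) (auto simp: single_splits_def rooted_lists_def)
    obtain r r' where "u = a # r" "u' = a # r'" and notin: "a \<notin> set r" "a \<notin> set w"
      using *[OF A(1)] *[OF A(2)] by blast
    with eq append_Cons_eq_iff[OF notin(2,1), of w' r'] show "u = u' \<and> w = w'" by simp
  qed
  show "(\<lambda>(u, w). w @ u) ` single_splits wt a S = positive_permutations S wt"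
  proof (intro equalityI subsetI)
    fix xs assume "xs \<in> positive_permutations S wt"
    then have xs: "distinct xs" "set xs = S" "positive_list wt xs"
      by (auto simp: positive_permutations_eq[OF assms(2)])
    then have "a \<in> set xs" using assms(1) by simp
    then obtain w r where wr: "xs = w @ a # r" using split_list by fast
    with xs have "(a # r, w) \<in> single_splits wt a S"
      by (auto simp: single_splits_def rooted_lists_def)
    with wr show "xs \<in> (\<lambda>(u, w). w @ u) ` single_splits wt a S"
      by (intro image_eqI[of _ _ "(a # r, w)"]) auto
  qed (auto simp: positive_permutations_eq[OF assms(2)] single_splits_def rooted_lists_def)
qed

text \<open>Taking out \<open>v\<close> leaves a rooted list on \<open>B\<close> with the same first
  minimum, and that minimum marks where \<open>v\<close> has to be put back.\<close>

lemma bij_block_splits: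
  assumes "finite S" "a \<in> S" "sum wt S = 0"
  shows "bij_betw (\<lambda>(u, v, w). (set (u @ w), u @ w, v)) (block_splits wt a S)
    (SIGMA B:{B. B \<subset> S \<and> a \<in> B \<and> sum wt B = 0}.
       rooted_lists a B \<times> positive_permutations (S - B) wt)"
    (is "bij_betw ?f _ ?T")
  unfolding bij_betw_def
proof
  show "inj_on ?f (block_splits wt a S)"
  proof (rule inj_onI)
    fix x y assume xy: "x \<in> block_splits wt a S" "y \<in> block_splits wt a S" "?f x = ?f y"
    obtain u v w u' v' w' where uvw: "x = (u, v, w)" "y = (u', v', w')"
      by (cases x; cases y) blast
    note fm = block_splits_first_min(2)[of _ _ _ wt a S]
    from xy uvw have "u = u' \<and> w = w'" by (intro first_min_unique[OF fm fm]) auto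
    with xy uvw show "x = y" by simp
  qed
  show "?f ` block_splits wt a S = ?T"
  proof (intro equalityI subsetI)
    fix z assume "z \<in> ?f ` block_splits wt a S"
    then obtain u v w where z: "z = ?f (u, v, w)" and uvw: "(u, v, w) \<in> block_splits wt a S"
      by force
    note fm = block_splits_first_min[OF uvw]
    have r: "distinct (u @ v @ w)" "set (u @ v @ w) = S" "hd (u @ v @ w) = a"
      using uvw by (auto simp: block_splits_def rooted_lists_def)
    have u: "u \<noteq> []" by (rule first_minD(1)[OF fm(1)])
    define B where "B = set (u @ w)"
    have v: "set v = S - B" using r by (auto simp: B_def)
    have v0: "sum wt (S - B) = 0"
      using positive_listD(1)[OF fm(4)] weight_eq_sum[of v wt] r v by simp
    have BS: "B \<subseteq> S" using r by (auto simp: B_def)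
    then have B0: "sum wt B = 0" using v0 assms by (simp add: sum_diff)
    have "B \<noteq> S" using v fm(3) by auto
    with BS have "B \<subset> S" by blast
    moreover have "a \<in> B" using r(3) u by (auto simp: B_def)
    moreover have "u @ w \<in> rooted_lists a B" using r u by (auto simp: rooted_lists_def B_def)
    moreover have "v \<in> positive_permutations (S - B) wt"
      using r v fm(4) by (auto simp: positive_permutations_eq[OF v0])
    ultimately show "z \<in> ?T" using z B0 by (auto simp: B_def)
  next
    fix z assume "z \<in> ?T"
    then obtain B ys v where z: "z = (B, ys, v)" and B: "B \<subset> S" "a \<in> B" "sum wt B = 0"
      and ys: "ys \<in> rooted_lists a B" and v: "v \<in> positive_permutations (S - B) wt" by auto
    have v0: "sum wt (S - B) = 0" using B assms by (simp add: sum_diff psubset_imp_subset)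
    have v': "distinct v" "set v = S - B" "positive_list wt v"
      using v by (auto simp: positive_permutations_eq[OF v0])
    have "ys \<noteq> []" using ys B by (auto simp: rooted_lists_def)
    then obtain u w where uw: "ys = u @ w" "first_min wt u w" using ex_first_min by blast
    \<comment> \<open>Here \<open>v\<close> is nonempty because \<open>B\<close> is a proper subset
      of \<open>S\<close>.\<close>
    have "(u, v, w) \<in> block_splits wt a S"
      using ys v' uw B first_minD(1)[OF uw(2)] by (auto simp: block_splits_def rooted_lists_def)
    moreover have "z = ?f (u, v, w)" using z ys uw by (auto simp: rooted_lists_def)
    ultimately show "z \<in> ?f ` block_splits wt a S" by blast
  qed
qed

text \<open>Each rooted list is cut at its first minimum; the two summands count the lists whose
  minimum is attained once and those where it recurs.\<close>

lemma fact_eq_positive_permutations: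
  assumes "finite S" "a \<in> S" "sum wt S = 0"
  shows "fact (card S - 1) = card (positive_permutations S wt) +
    (\<Sum>B | B \<subset> S \<and> a \<in> B \<and> sum wt B = 0.
       fact (card B - 1) * card (positive_permutations (S - B) wt))"
proof -
  let ?Z = "{B. B \<subset> S \<and> a \<in> B \<and> sum wt B = 0}"
  let ?f = "\<lambda>(u, w). u @ w" and ?g = "\<lambda>(u, v, w). u @ v @ w"
  let ?L1 = "?f ` single_splits wt a S" and ?L2 = "?g ` block_splits wt a S"
  have inj1: "inj_on ?f (single_splits wt a S)"
    by (intro inj_onI, clarify)
       (meson single_splits_first_min(1)[OF _ assms(3)] first_min_unique)
  have inj2: "inj_on ?g (block_splits wt a S)"
  proof (rule inj_onI)
    fix x y assume xy: "x \<in> block_splits wt a S" "y \<in> block_splits wt a S" "?g x = ?g y"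
    obtain u v w u' v' w' where uvw: "x = (u, v, w)" "y = (u', v', w')"
      by (cases x; cases y) blast
    with xy have A: "(u, v, w) \<in> block_splits wt a S" "(u', v', w') \<in> block_splits wt a S"
      and eq: "u @ v @ w = u' @ v' @ w'" by auto
    note fm = block_splits_first_min[OF A(1)] block_splits_first_min[OF A(2)]
    have "u = u'" "v @ w = v' @ w'" using first_min_unique[OF fm(1,5) eq] by auto
    with positive_prefix_unique[OF fm(4,8,3,7)] uvw show "x = y" by blast
  qed
  have disj: "?L1 \<inter> ?L2 = {}"
  proof (rule ccontr)
    assume "?L1 \<inter> ?L2 \<noteq> {}"
    then obtain u w u' v' w' where A: "(u, w) \<in> single_splits wt a S"
      "(u', v', w') \<in> block_splits wt a S" "u @ w = u' @ v' @ w'" by auto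
    note fm = block_splits_first_min[OF A(2)]
    \<comment> \<open>Both cuts are at the same first minimum, so \<open>v'\<close> is a nonempty
      prefix of \<open>w\<close> of weight zero.\<close>
    have "w = v' @ w'"
      using first_min_unique[OF single_splits_first_min(1)[OF A(1) assms(3)] fm(1) A(3)] by simp
    with single_splits_first_min(2)[OF A(1) assms(3)] fm(3) positive_listD(1)[OF fm(4)]
    show False by fastforce
  qed
  have un: "rooted_lists a S = ?L1 \<union> ?L2"
  proof (intro equalityI subsetI)
    fix xs assume xs: "xs \<in> rooted_lists a S"
    have "xs \<noteq> []" using xs assms(2) by (auto simp: rooted_lists_def)
    then obtain u w where uw: "xs = u @ w" "first_min wt u w" using ex_first_min by blast
    have w0: "weight wt (u @ w) = 0" using rooted_lists_weight[OF xs assms(3)] uw by simp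
    note u = first_minD(1)[OF uw(2)]
    show "xs \<in> ?L1 \<union> ?L2"
    \<comment> \<open>Prefixes of \<open>w\<close> have nonnegative weight, so this asks whether the
      minimum recurs after \<open>u\<close>.\<close>
    proof (cases "\<exists>x y. w = x @ y \<and> x \<noteq> [] \<and> weight wt x \<le> 0")
      case True
      then obtain v w' where v: "w = v @ w'" "v \<noteq> []" "positive_list wt v"
        using ex_positive_prefix[of w wt] first_minD(3)[OF uw(2)] by blast
      then have "first_min wt u w'" using uw(2) first_min_insert_iff by blast
      with v xs uw have "(u, v, w') \<in> block_splits wt a S" by (auto simp: block_splits_def)
      with uw v show ?thesis by force
    next
      case False
      then have "\<forall>x y. w = x @ y \<longrightarrow> x \<noteq> [] \<longrightarrow> weight wt x > 0" by force
      with uw(2) have "positive_list wt (w @ u)" using positive_rotate_iff[OF u w0] by blast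
      with xs uw u have "(u, w) \<in> single_splits wt a S" by (auto simp: single_splits_def)
      with uw show ?thesis by force
    qed
  qed (auto simp: single_splits_def block_splits_def)
  have fin: "finite (rooted_lists a S)" by (rule finite_rooted_lists[OF assms(1)])
  have finP: "finite (positive_permutations T wt)" for T
    by (rule finite_subset[OF _ finite_permutations_of_set[of T]])
      (auto simp: positive_permutations_def)
  have finZ: "finite ?Z" using assms(1) by (auto intro: finite_subset[of _ "Pow S"])
  have "fact (card S - 1) = card (rooted_lists a S)"
    using card_rooted_lists assms by metis
  also have "\<dots> = card ?L1 + card ?L2"
    unfolding un using fin by (intro card_Un_disjoint disj) (auto simp: un)
  also have "card ?L1 = card (positive_permutations S wt)"
    using card_image[OF inj1] bij_betw_same_card[OF bij_single_splits[OF assms(2,3)]] by simp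
  also have "card ?L2 = card (SIGMA B:?Z. rooted_lists a B \<times> positive_permutations (S - B) wt)"
    using card_image[OF inj2] bij_betw_same_card[OF bij_block_splits[OF assms]] by simp
  also have "\<dots> = (\<Sum>B\<in>?Z. card (rooted_lists a B \<times> positive_permutations (S - B) wt))"
    using finZ assms(1) finP
    by (intro card_SigmaI)
      (auto intro!: finite_cartesian_product finite_rooted_lists intro: finite_subset)
  also have "\<dots> = (\<Sum>B\<in>?Z. fact (card B - 1) * card (positive_permutations (S - B) wt))"
    using assms(1) by (intro sum.cong refl)
      (auto simp: card_cartesian_product card_rooted_lists finite_subset psubset_imp_subset)
  finally show ?thesis .
qed

section \<open>The recurrence for partitions\<close>

text \<open>The exponent is \<open>card p\<close>, not \<open>card p - 1\<close>, so that adding a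
  block always flips the sign, even for the empty partition.\<close>

definition signed_partition_sum :: "'a set \<Rightarrow> ('a \<Rightarrow> real) \<Rightarrow> int" where
  "signed_partition_sum S wt = (\<Sum>p\<in>passport_partitions S wt. (-1) ^ card p * int (X p))"

lemma finite_passport_partitions: "finite S \<Longrightarrow> finite (passport_partitions S wt)"
  by (rule finite_subset[of _ "{p. partition_on S p}"])
     (auto simp: passport_partitions_def finitely_many_partition_on)

lemma signed_partition_sum_empty [simp]: "signed_partition_sum {} wt = 1"
proof -
  have "passport_partitions {} wt = {{}}"
    by (auto simp: passport_partitions_def partition_on_empty)
  then show ?thesis by (simp add: signed_partition_sum_def X_def)
qed

text \<open>\<open>B\<close> is recovered as the only block containing \<open>a\<close>, because the
  blocks in \<open>q\<close> lie in \<open>S - B\<close>.\<close>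

lemma bij_insert_block:
  assumes "finite S" "a \<in> S"
  shows "bij_betw (\<lambda>(B, q). insert B q)
    (SIGMA B:{B. B \<subseteq> S \<and> a \<in> B \<and> full_passport B wt}. passport_partitions (S - B) wt)
    (passport_partitions S wt)"
    (is "bij_betw ?f ?T _")
  unfolding bij_betw_def
proof
  show "inj_on ?f ?T"
  proof (intro inj_onI, clarify)
    fix B q B' q'
    assume B: "a \<in> B" "a \<in> B'"
      and q: "q \<in> passport_partitions (S - B) wt" "q' \<in> passport_partitions (S - B') wt"
      and eq: "insert B q = insert B' q'"
    have U: "\<Union>q = S - B" "\<Union>q' = S - B'"
      using q by (auto simp: passport_partitions_def partition_on_def)
    then have "B \<notin> q" "B \<notin> q'" "B' \<notin> q" "B' \<notin> q'" using B by blast+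
    with eq show "B = B' \<and> q = q'" by (metis insertE insertI1 insert_ident)
  qed
  show "?f ` ?T = passport_partitions S wt"
  proof (intro equalityI subsetI)
    fix p assume "p \<in> ?f ` ?T"
    then obtain B q where p: "p = insert B q" and B: "B \<subseteq> S" "a \<in> B" "full_passport B wt"
      and q: "partition_on (S - B) q" "\<forall>C\<in>q. full_passport C wt"
      by (auto simp: passport_partitions_def)
    have "disjnt B (\<Union>q)" using q(1) by (auto simp: disjnt_def partition_on_def)
    then have "partition_on S (insert B q)"
      using q(1) B by (auto simp: partition_on_insert)
    then show "p \<in> passport_partitions S wt"
      using p B q by (auto simp: passport_partitions_def)
  next
    fix p assume "p \<in> passport_partitions S wt"
    then have p: "partition_on S p" "\<forall>C\<in>p. full_passport C wt"
      by (auto simp: passport_partitions_def)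
    then obtain B where B: "B \<in> p" "a \<in> B" using assms by (auto simp: partition_on_def)
    have "partition_on (S - B) (p - {B})"
      using p(1) B(1) unfolding partition_on_def disjoint_def by blast
    with p B have "(B, p - {B}) \<in> ?T"
      by (auto simp: passport_partitions_def partition_on_def)
    moreover have "p = ?f (B, p - {B})" using B by auto
    ultimately show "p \<in> ?f ` ?T" by blast
  qed
qed

text \<open>Partitions are sorted by the block \<open>B\<close> of \<open>a\<close>, which
  contributes one sign and the factor \<open>fact (card B - 1)\<close>.\<close>

lemma signed_partition_sum_rec:
  assumes "finite S" "a \<in> S"
  shows "signed_partition_sum S wt =
    - (\<Sum>B | B \<subseteq> S \<and> a \<in> B \<and> full_passport B wt.
         fact (card B - 1) * signed_partition_sum (S - B) wt)"
proof -
  let ?Z = "{B. B \<subseteq> S \<and> a \<in> B \<and> full_passport B wt}"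
  have term_insert: "(-1) ^ card (insert B q) * int (X (insert B q)) =
      - (fact (card B - 1) * ((-1) ^ card q * int (X q)))"
    if B: "B \<in> ?Z" and q: "q \<in> passport_partitions (S - B) wt" for B q
  proof -
    have part: "partition_on (S - B) q" using q by (simp add: passport_partitions_def)
    then have "finite q" using assms(1) finite_elements by blast
    moreover have "B \<notin> q" using part B by (auto simp: partition_on_def)
    ultimately show ?thesis by (simp add: X_def)
  qed
  have "signed_partition_sum S wt =
      (\<Sum>(B, q)\<in>(SIGMA B:?Z. passport_partitions (S - B) wt).
         (-1) ^ card (insert B q) * int (X (insert B q)))"
    unfolding signed_partition_sum_def
    by (subst sum.reindex_bij_betw[OF bij_insert_block[OF assms], symmetric])
      (simp add: case_prod_unfold)
  also have "\<dots> = (\<Sum>B\<in>?Z. \<Sum>q\<in>passport_partitions (S - B) wt.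
         (-1) ^ card (insert B q) * int (X (insert B q)))"
    using assms(1)
    by (intro sum.Sigma[symmetric])
      (auto intro: finite_subset[of _ "Pow S"] finite_passport_partitions)
  also have "\<dots> = (\<Sum>B\<in>?Z. \<Sum>q\<in>passport_partitions (S - B) wt.
         - (fact (card B - 1) * ((-1) ^ card q * int (X q))))"
    by (intro sum.cong refl term_insert)
  also have "\<dots> = - (\<Sum>B\<in>?Z. fact (card B - 1) * signed_partition_sum (S - B) wt)"
    by (simp add: signed_partition_sum_def sum_negf sum_distrib_left)
  finally show ?thesis .
qed

lemma signed_partition_sum_eq:
  assumes "full_passport S wt" "S \<noteq> {}"
  shows "signed_partition_sum S wt = - int (card (positive_permutations S wt))"
  using assms
proof (induction "card S" arbitrary: S rule: less_induct)
  case less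
  have fin: "finite S" and nz: "\<And>s. s \<in> S \<Longrightarrow> wt s \<noteq> 0" and s0: "sum wt S = 0"
    using less.prems by (auto simp: full_passport_def)
  obtain a where a: "a \<in> S" using less.prems by blast
  let ?Z = "{B. B \<subset> S \<and> a \<in> B \<and> sum wt B = 0}"
  have finZ: "finite ?Z" using fin by (auto intro: finite_subset[of _ "Pow S"])
  \<comment> \<open>The block \<open>B = S\<close> is set apart: the induction hypothesis excludes
    the empty complement, whose sum is \<open>1\<close> and not \<open>-1\<close>.\<close>
  have "{B. B \<subseteq> S \<and> a \<in> B \<and> full_passport B wt} = insert S ?Z"
    using fin nz s0 a by (auto simp: full_passport_def intro: finite_subset)
  then have "signed_partition_sum S wt =
      - (\<Sum>B\<in>insert S ?Z. fact (card B - 1) * signed_partition_sum (S - B) wt)"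
    using signed_partition_sum_rec[OF fin a] by simp
  also have "\<dots> = - (fact (card S - 1)
      + (\<Sum>B\<in>?Z. fact (card B - 1) * signed_partition_sum (S - B) wt))"
    using finZ by simp
  also have "(\<Sum>B\<in>?Z. fact (card B - 1) * signed_partition_sum (S - B) wt) =
      - (\<Sum>B\<in>?Z. fact (card B - 1) * int (card (positive_permutations (S - B) wt)))"
    unfolding sum_negf[symmetric]
  proof (intro sum.cong refl)
    fix B assume B: "B \<in> ?Z"
    then have "card (S - B) < card S" using fin a by (intro psubset_card_mono) auto
    moreover have "full_passport (S - B) wt"
      using B fin nz s0 by (auto simp: full_passport_def sum_diff)
    moreover have "S - B \<noteq> {}" using B by blast
    ultimately show "fact (card B - 1) * signed_partition_sum (S - B) wt =
        - (fact (card B - 1) * int (card (positive_permutations (S - B) wt)))"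
      using less.hyps[of "S - B"] by simp
  qed
  \<comment> \<open>After this substitution the sums over \<open>?Z\<close> cancel.\<close>
  also have "(fact (card S - 1) :: int) = int (card (positive_permutations S wt)) +
      (\<Sum>B\<in>?Z. fact (card B - 1) * int (card (positive_permutations (S - B) wt)))"
    using arg_cong[OF fact_eq_positive_permutations[OF fin a s0], of int] by simp
  finally show ?case by simp
qed

theorem theorem3p8:
  fixes S :: "'a set" and wt :: "'a \<Rightarrow> real"
  assumes "full_passport S wt" and "card S \<ge> 2"
  shows "int (card (positive_permutations S wt)) =
         (\<Sum>p\<in>passport_partitions S wt. (-1) ^ (card p - 1) * int (X p))"
proof -
  have fin: "finite S" and ne: "S \<noteq> {}" using assms by (auto simp: full_passport_def)
  have "(\<Sum>p\<in>passport_partitions S wt. (-1) ^ (card p - 1) * int (X p)) =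
      - signed_partition_sum S wt"
    unfolding signed_partition_sum_def sum_negf[symmetric]
  proof (intro sum.cong refl)
    fix p assume "p \<in> passport_partitions S wt"
    then have p: "partition_on S p" by (simp add: passport_partitions_def)
    then have "finite p" "p \<noteq> {}"
      using fin ne finite_elements by (auto simp: partition_on_def)
    \<comment> \<open>Subtraction on naturals truncates, so the shift of the exponent needs at least
      one block.\<close>
    then have "card p > 0" by (simp add: card_gt_0_iff)
    then have "(-1 :: int) ^ card p = - ((-1) ^ (card p - 1))"
      by (metis Suc_diff_1 mult_minus1 power_Suc)
    then show "(-1) ^ (card p - 1) * int (X p) = - ((-1) ^ card p * int (X p))" by simp
  qed
  then show ?thesis using signed_partition_sum_eq[OF assms(1) ne] by simp
qed

end
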